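(* Let $X$ be either $\mathbb R^n$ or a fixed cube $Q\subset\mathbb R^n$, $n\ge1$, and let $\varphi$ be such that $e^\varphi\in A_\infty(X)$. For $c,d\in\mathbb R$ with $c<d$, let $$\varphi_{c,d}=c\,\chi_{\{\varphi\le c\}}+\varphi\,\chi_{\{c<\varphi<d\}}+d\,\chi_{\{\varphi\ge d\}}.$$ Then for any cube $J\subset X$, $$\big\langle e^{\varphi_{c,d}-\langle\varphi_{c,d}\rangle_J}\big\rangle_J\le\big\langle e^{\varphi-\langle\varphi\rangle_J}\big\rangle_J$$ and, consequently, $$\big[e^{\varphi_{c,d}}\big]_{A_\infty(X)}\le\big[e^{\varphi}\big]_{A_\infty(X)}.$$
   Context: For a cube $J\subset\mathbb R^n$, $\langle\varphi\rangle_J=\frac1{|J|}\int_J\varphi$. An a.e. positive function $w$ is in $A_\infty(X)$ if $w$ and $\log w$ are locally integrable and $[w]_{A_\infty(X)}:=\sup_{J\subset X}\langle w\rangle_Je^{-\langle\log w\rangle_J}<\infty$, the supremum being over all cubes $J\subset X$. $\chi_S$ denotes the characteristic function of $S$. *)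

theory Defs
  imports "HOL-Analysis.Analysis"
begin

text \<open>Cubes are closed, non-degenerate, with sides parallel to the coordinate axes.\<close>

definition is_cube :: "(real ^ 'n) set \<Rightarrow> bool" where
  "is_cube J \<longleftrightarrow> (\<exists>a l. 0 < l \<and> J = cbox a (\<chi> i. a $ i + l))"

definition avg :: "(real ^ 'n) set \<Rightarrow> (real ^ 'n \<Rightarrow> real) \<Rightarrow> real" where
  "avg J f = (1 / measure lebesgue J) * (LINT x:J|lebesgue. f x)"

definition locally_integrable_on :: "(real ^ 'n \<Rightarrow> real) \<Rightarrow> (real ^ 'n) set \<Rightarrow> bool" where
  "locally_integrable_on f X \<longleftrightarrow>
     (\<forall>K. compact K \<longrightarrow> K \<subseteq> X \<longrightarrow> f absolutely_integrable_on K)"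

text \<open>The supremum is taken in the extended reals, so that it is meaningful also when infinite.\<close>

definition A_inf_const :: "(real ^ 'n) set \<Rightarrow> (real ^ 'n \<Rightarrow> real) \<Rightarrow> ereal" where
  "A_inf_const X w =
     (SUP J \<in> {J. is_cube J \<and> J \<subseteq> X}. ereal (avg J w * exp (- avg J (\<lambda>x. ln (w x)))))"

definition A_inf :: "(real ^ 'n) set \<Rightarrow> (real ^ 'n \<Rightarrow> real) set" where
  "A_inf X = {w. (AE x in lebesgue. x \<in> X \<longrightarrow> 0 < w x)
      \<and> locally_integrable_on w X
      \<and> locally_integrable_on (\<lambda>x. ln (w x)) X
      \<and> A_inf_const X w < \<infinity>}"

definition cutoff :: "real \<Rightarrow> real \<Rightarrow> (real ^ 'n \<Rightarrow> real) \<Rightarrow> real ^ 'n \<Rightarrow> real" where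
  "cutoff c d \<phi> x =
     c * indicator {y. \<phi> y \<le> c} x + \<phi> x * indicator {y. c < \<phi> y \<and> \<phi> y < d} x
       + d * indicator {y. \<phi> y \<ge> d} x"

end

theory Submission
  imports Defs "HOL-Probability.Probability_Measure"
begin

text \<open>
  Normalise Lebesgue measure on \<open>J\<close> to a probability measure with expectation \<open>E\<close>, write \<open>\<psi>\<close>
  for the truncation of \<open>\<phi>\<close>, and put \<open>h = \<phi> - \<psi>\<close>, \<open>k = E h\<close>, \<open>t = E e\<^sup>\<psi>\<close>.
  The tangent line of the exponential at \<open>k\<close> gives
  \<open>e\<^sup>\<phi> = e\<^sup>\<psi> e\<^sup>h \<ge> e\<^sup>k e\<^sup>\<psi> (1 + h - k)\<close>.
  Moreover \<open>(e\<^sup>\<psi> - t) h \<ge> 0\<close> pointwise, because \<open>e\<^sup>\<psi>\<close> attains its largest possible value where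
  \<open>h > 0\<close> and its smallest possible value where \<open>h < 0\<close>; hence \<open>E (e\<^sup>\<psi> h) \<ge> t k\<close>.
  Taking expectations yields \<open>E e\<^sup>\<phi> \<ge> e\<^sup>k E e\<^sup>\<psi>\<close>, which is the claim.
\<close>

lemma (in prob_space) expectation_exp_truncation_le:
  fixes f :: "'a \<Rightarrow> real" and c d :: real
  defines "g \<equiv> \<lambda>x. max c (min d (f x))"
  assumes f: "integrable M f" and ef: "integrable M (\<lambda>x. exp (f x))" and "c < d"
  shows "expectation (\<lambda>x. exp (g x - expectation g)) \<le> expectation (\<lambda>x. exp (f x - expectation f))"
proof -
  have [measurable]: "f \<in> borel_measurable M"
    using f by auto
  have g_meas [measurable]: "g \<in> borel_measurable M"
    unfolding g_def by measurable
  have g_bounds: "c \<le> g x" "g x \<le> d" for x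
    using \<open>c < d\<close> by (auto simp: g_def)
  have g: "integrable M g"
  proof (rule integrable_const_bound)
    have "\<bar>g x\<bar> \<le> \<bar>c\<bar> + \<bar>d\<bar>" for x
      using g_bounds[of x] by linarith
    then show "AE x in M. norm (g x) \<le> \<bar>c\<bar> + \<bar>d\<bar>"
      by simp
  qed simp
  have eg: "integrable M (\<lambda>x. exp (g x))"
    using g_bounds by (intro integrable_const_bound[where B = "exp d"]) auto
  define h where "h = (\<lambda>x. f x - g x)"
  have h: "integrable M h"
    unfolding h_def using f g by simp
  \<comment> \<open>The factor \<open>exp (g x)\<close> is at most \<open>exp d\<close>, so the
    product is dominated by a multiple of the integrable \<open>h\<close>.\<close>
  have egh: "integrable M (\<lambda>x. exp (g x) * h x)"
  proof (rule Bochner_Integration.integrable_bound)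
    show "integrable M (\<lambda>x. exp d * h x)"
      using h by simp
    show "AE x in M. norm (exp (g x) * h x) \<le> norm (exp d * h x)"
      using g_bounds by (auto simp: abs_mult intro!: mult_right_mono)
  qed (simp add: h_def)
  define k where "k = expectation h"
  define t where "t = expectation (\<lambda>x. exp (g x))"
  have k_eq: "k = expectation f - expectation g"
    unfolding k_def h_def using f g by simp
  \<comment> \<open>A mean of values in \<open>[exp c, exp d]\<close> stays there. This fixes the
    sign of \<open>exp (g x) - t\<close> where \<open>g x\<close> is \<open>c\<close> or
    \<open>d\<close>, and elsewhere \<open>h x = 0\<close>.\<close>
  have t_bounds: "exp c \<le> t" "t \<le> exp d"
    unfolding t_def using g_bounds
    by (auto intro!: integral_ge_const integral_le_const eg)
  have sign: "0 \<le> (exp (g x) - t) * h x" for x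
  proof -
    consider "f x \<le> c" | "c < f x" "f x < d" | "d \<le> f x"
      by linarith
    then show ?thesis
    proof cases
      case 1
      then show ?thesis
        using \<open>c < d\<close> t_bounds by (intro mult_nonpos_nonpos) (auto simp: g_def h_def)
    next
      case 2
      then show ?thesis
        by (simp add: g_def h_def)
    next
      case 3
      then show ?thesis
        using \<open>c < d\<close> t_bounds by (intro mult_nonneg_nonneg) (auto simp: g_def h_def)
    qed
  qed
  have "0 \<le> expectation (\<lambda>x. (exp (g x) - t) * h x)"
    by (intro Bochner_Integration.integral_nonneg sign)
  also have "\<dots> = expectation (\<lambda>x. exp (g x) * h x) - t * k"
    using egh h by (simp add: left_diff_distrib k_def)
  finally have cov: "t * k \<le> expectation (\<lambda>x. exp (g x) * h x)"
    by simp
  have tangent: "exp k * (exp (g x) * h x + (1 - k) * exp (g x)) \<le> exp (f x)" for x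
  proof -
    have "1 + (h x - k) \<le> exp (h x - k)"
      by (rule exp_ge_add_one_self)
    then have "exp k * exp (g x) * (1 + (h x - k)) \<le> exp k * exp (g x) * exp (h x - k)"
      by (intro mult_left_mono) auto
    also have "\<dots> = exp (f x)"
      by (simp add: h_def flip: exp_add)
    finally show ?thesis
      by (simp add: algebra_simps)
  qed
  \<comment> \<open>By \<open>cov\<close> the bracket is at least
    \<open>t * k + (1 - k) * t\<close>, where the terms in \<open>k\<close> cancel and leave
    \<open>t\<close>.\<close>
  have "exp k * t \<le> exp k * (expectation (\<lambda>x. exp (g x) * h x) + (1 - k) * t)"
    using cov by (simp add: algebra_simps)
  also have "\<dots> = expectation (\<lambda>x. exp k * (exp (g x) * h x + (1 - k) * exp (g x)))"
    using egh eg by (simp add: t_def)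
  also have "\<dots> \<le> expectation (\<lambda>x. exp (f x))"
    using egh eg ef tangent by (intro integral_mono) auto
  finally have "exp k * t * exp (- expectation f) \<le> expectation (\<lambda>x. exp (f x)) * exp (- expectation f)"
    by (intro mult_right_mono) auto
  moreover have "exp k * t * exp (- expectation f) = t * exp (- expectation g)"
    by (simp add: k_eq mult.commute mult.left_commute flip: exp_add)
  ultimately have "t * exp (- expectation g) \<le> expectation (\<lambda>x. exp (f x)) * exp (- expectation f)"
    by simp
  then show ?thesis
    by (simp add: exp_diff t_def exp_minus divide_inverse)
qed

text \<open>For \<open>c < d\<close> the three level sets partition the space; as a clamp, the
  truncation is visibly bounded and measurable.\<close>

lemma cutoff_eq_max_min: "c < d \<Longrightarrow> cutoff c d f = (\<lambda>x. max c (min d (f x)))"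
  by (auto simp: cutoff_def fun_eq_iff indicator_def max_def min_def)

lemma is_cube_measure_pos:
  assumes "is_cube J"
  shows "0 < measure lebesgue J"
proof -
  obtain a l where "0 < l" and J: "J = cbox a (\<chi> i. a $ i + l)"
    using assms by (auto simp: is_cube_def)
  then have "box a (\<chi> i. a $ i + l) \<noteq> {}"
    by (simp add: interval_ne_empty_cart)
  then show ?thesis
    by (simp add: J content_pos_lt_eq box_ne_empty)
qed

lemma is_cube_compact: "is_cube J \<Longrightarrow> compact J"
  by (auto simp: is_cube_def)

text \<open>The constant density normalises the total mass of a cube to 1, so that averages over it
  become expectations.\<close>

definition cube_measure :: "(real ^ 'n) set \<Rightarrow> (real ^ 'n) measure" where
  "cube_measure J = density (restrict_space lebesgue J) (\<lambda>_. ennreal (1 / measure lebesgue J))"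

lemma is_cube_sets_lebesgue: "is_cube J \<Longrightarrow> J \<in> sets lebesgue"
  by (auto simp: is_cube_def)

lemma prob_space_cube_measure:
  assumes "is_cube J"
  shows "prob_space (cube_measure J)"
proof
  have J: "J \<in> sets lebesgue"
    using assms by (rule is_cube_sets_lebesgue)
  have "emeasure lebesgue J = ennreal (measure lebesgue J)"
    using assms by (intro emeasure_eq_measure2 lmeasurable_compact is_cube_compact)
  then have "emeasure (cube_measure J) (space (cube_measure J))
      = ennreal (1 / measure lebesgue J) * ennreal (measure lebesgue J)"
    using J by (simp add: cube_measure_def emeasure_density_const space_restrict_space
        sets_restrict_space_iff emeasure_restrict_space del: emeasure_completion)
  also have "\<dots> = 1"
    using is_cube_measure_pos[OF assms] by (simp flip: ennreal_mult)
  finally show "emeasure (cube_measure J) (space (cube_measure J)) = 1" .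
qed

lemma measurable_cube_measure [simp]:
  "borel_measurable (cube_measure J) = borel_measurable (restrict_space lebesgue J)"
  unfolding cube_measure_def by (intro measurable_cong_sets) simp_all

text \<open>Measurability suffices: if \<open>f\<close> is not integrable, both sides take the
  default value 0.\<close>

lemma avg_eq_integral_cube_measure:
  fixes f :: "real ^ 'n \<Rightarrow> real"
  assumes "is_cube J" and f: "f \<in> borel_measurable (cube_measure J)"
  shows "avg J f = integral\<^sup>L (cube_measure J) f"
proof -
  have "integral\<^sup>L (cube_measure J) f
      = integral\<^sup>L (restrict_space lebesgue J) (\<lambda>x. 1 / measure lebesgue J * f x)"
    unfolding cube_measure_def using f by (subst integral_density) auto
  also have "\<dots> = avg J f"
    using is_cube_sets_lebesgue[OF \<open>is_cube J\<close>]
    by (simp add: avg_def integral_restrict_space set_lebesgue_integral_def)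
  finally show ?thesis ..
qed

lemma integrable_cube_measure:
  fixes f :: "real ^ 'n \<Rightarrow> real"
  assumes "is_cube J" and "f absolutely_integrable_on J"
  shows "integrable (cube_measure J) f"
proof -
  have f: "integrable (restrict_space lebesgue J) f"
    using assms is_cube_sets_lebesgue[OF \<open>is_cube J\<close>]
    by (simp add: integrable_restrict_space set_integrable_def)
  then show ?thesis
    unfolding cube_measure_def by (subst integrable_density) auto
qed

lemma avg_exp_cutoff_le:
  fixes f :: "real ^ 'n \<Rightarrow> real"
  assumes J: "is_cube J" and f: "f absolutely_integrable_on J"
    and ef: "(\<lambda>x. exp (f x)) absolutely_integrable_on J" and "c < d"
  shows "avg J (\<lambda>x. exp (cutoff c d f x - avg J (cutoff c d f))) \<le> avg J (\<lambda>x. exp (f x - avg J f))"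
proof -
  interpret prob_space "cube_measure J"
    using J by (rule prob_space_cube_measure)
  have meas [measurable]: "f \<in> borel_measurable (cube_measure J)"
    using integrable_cube_measure[OF J f] by (rule borel_measurable_integrable)
  show ?thesis
    unfolding cutoff_eq_max_min[OF \<open>c < d\<close>]
    using expectation_exp_truncation_le[OF integrable_cube_measure[OF J f]
        integrable_cube_measure[OF J ef] \<open>c < d\<close>]
    by (simp add: avg_eq_integral_cube_measure[OF J] del: measurable_cube_measure)
qed

text \<open>Links the centred averages of the cubewise inequality to the products under the supremum
  in \<open>A_inf_const\<close>.\<close>

lemma avg_exp_minus_const: "avg J (\<lambda>x. exp (f x - m)) = avg J (\<lambda>x. exp (f x)) * exp (- m)"
  by (simp add: avg_def exp_diff exp_minus divide_inverse)

theorem lemma4p2: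
  fixes X :: "(real ^ 'n) set" and \<phi> :: "real ^ 'n \<Rightarrow> real" and c d :: real
  assumes "X = UNIV \<or> is_cube X"
    and "(\<lambda>x. exp (\<phi> x)) \<in> A_inf X"
    and "c < d"
  shows "(\<forall>J. is_cube J \<and> J \<subseteq> X \<longrightarrow>
            avg J (\<lambda>x. exp (cutoff c d \<phi> x - avg J (cutoff c d \<phi>)))
              \<le> avg J (\<lambda>x. exp (\<phi> x - avg J \<phi>)))
       \<and> A_inf_const X (\<lambda>x. exp (cutoff c d \<phi> x)) \<le> A_inf_const X (\<lambda>x. exp (\<phi> x))"
proof -
  \<comment> \<open>Since \<open>ln (exp y) = y\<close>, membership in \<open>A_inf X\<close> makes
    both \<phi> and its exponential integrable on the compact set \<open>J\<close>.\<close>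
  have main: "avg J (\<lambda>x. exp (cutoff c d \<phi> x - avg J (cutoff c d \<phi>)))
      \<le> avg J (\<lambda>x. exp (\<phi> x - avg J \<phi>))" if "is_cube J" "J \<subseteq> X" for J
    using assms(2) that is_cube_compact[OF that(1)]
    by (intro avg_exp_cutoff_le[OF that(1) _ _ \<open>c < d\<close>])
      (auto simp: A_inf_def locally_integrable_on_def)
  \<comment> \<open>Both suprema range over the same cubes, so each cube serves as its own
    witness.\<close>
  moreover have "A_inf_const X (\<lambda>x. exp (cutoff c d \<phi> x)) \<le> A_inf_const X (\<lambda>x. exp (\<phi> x))"
    unfolding A_inf_const_def
    using main by (intro SUP_mono) (auto simp: avg_exp_minus_const)
  ultimately show ?thesis
    by blast
qed

end
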